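(* Let $G=(V,E)$ be a graph, $F=\{u_1v_1,\dots,u_tv_t\}\subseteq E$, and $G'=(V',E')$ a triangular elimination of $G$ with respect to $F$ with node $w_i$ associated with edge $u_iv_i$. Let $(\bm{a}')^{\mathrm{T}}\bm{x}\le a'_0$ be a triangular elimination of $\bm{a}^{\mathrm{T}}\bm{x}\le a_0$. Then $(\bm{a}')^{\mathrm{T}}\bm{x}\le a'_0$ is facet inducing for $\mathrm{CUT}^\square(G')$ if the following conditions hold: (i) $\bm{a}^{\mathrm{T}}\bm{x}\le a_0$ is facet inducing for $\mathrm{CUT}^\square(G)$; (ii) for $i=1,\dots,t$, $\mathrm{N}_{G'}(w_i)\setminus\{u_i,v_i\}\subseteq\mathrm{N}_G(u_i)\cap\mathrm{N}_G(v_i)$; (iii) for $i=1,\dots,t$, the inequality $\bm{a}^{\mathrm{T}}\bm{x}\le a_0$ is not completely supported by the edge set $\{u_il,v_il\mid l\in\mathrm{N}_{G'}(w_i)\}$.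
   Context: $\mathrm{N}_G(v)$ denotes the neighbourhood of node $v$ in graph $G$. For a graph $G=(V,E)$ and $S\subseteq V$, the cut vector $\bm{\delta}_G(S)\in\mathbb{R}^E$ has $uv$-coordinate $1$ if $|S\cap\{u,v\}|=1$ and $0$ otherwise; the cut polytope $\mathrm{CUT}^\square(G)$ is the convex hull of all cut vectors. An inequality is facet inducing for a polytope if it is valid and the face it defines is a facet. Coordinates are indexed by unordered pairs, $x_{uv}=x_{vu}$. The support graph of $\bm a\in\mathbb{R}^E$ has edge set $E(\bm a)=\{e\in E\mid a_e\ne0\}$ and node set the endpoints of these edges; the inequality $\bm a^{\mathrm T}\bm x\le a_0$ is completely supported by a set $D$ of edges (pairs) if $E(\bm a)\subseteq D$. For nodes $u,v,w$ define $\Delta(u,v;w)=x_{uv}-x_{uw}-x_{vw}$ and $\Delta(u,v,w)=x_{uv}+x_{uw}+x_{vw}-2$; $\Delta\{u,v,w\}$ denotes any one of $\Delta(u,v;w)$, $\Delta(w,v;u)$, $\Delta(u,w;v)$, $\Delta(u,v,w)$. Given $F=\{u_iv_i\mid i=1,\dots,t\}\subseteq E$, a graph $G'=(V',E')$ is a triangular elimination of $G$ with respect to $F$ if $V'=V\cup\{w_1,\dots,w_t\}$ with $w_i$ distinct nodes not in $V$, $E'\supseteq\{w_iu_i,w_iv_i\}$ for all $i$, and $E'\cap E=E\setminus F$; $w_i$ is associated with $u_iv_i$. Then $(\bm{a}')^{\mathrm{T}}\bm{x}\le a'_0$ ($\bm a'\in\mathbb{R}^{E'}$) is a triangular elimination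 of $\bm{a}^{\mathrm{T}}\bm{x}\le a_0$ ($\bm a\in\mathbb{R}^E$) if for some choices of triangular forms $\Delta_i\{u_i,v_i,w_i\}$ one has the identity of affine functions $(\bm{a}')^{\mathrm{T}}\bm{x}-a'_0=\bm{a}^{\mathrm{T}}\bm{x}-a_0+\sum_{i=1}^t|a_{u_iv_i}|\,\Delta_i\{u_i,v_i,w_i\}$.
   Formalization: Added assumption: every edge of G' between two nodes of V is an edge of G; E'∩E=E\F alone permits new edges inside V, and then the claim fails (F empty, G the path 1-2-3, G' the triangle, inequality x_12 ≤ 1). *)

theory Defs
  imports "HOL-Analysis.Analysis"
begin

text \<open>
  Nodes are taken from a finite type \<open>'v\<close>, and the space of vectors indexed by an edge set \<open>E\<close> is
  realised as the coordinate subspace \<open>edge_space E\<close> of \<open>real ^ ('v set)\<close>.  Hence the edge spaces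
  of different graphs live in one Euclidean space, and the coordinate \<open>uv\<close> is \<open>x $ {u, v}\<close>.
  Faces, facets and affine dimension are intrinsic, so this embedding does not affect them.
\<close>

definition simple_graph :: "'v set \<Rightarrow> 'v set set \<Rightarrow> bool" where
  "simple_graph V E \<longleftrightarrow> finite V \<and> E \<subseteq> {{u, v} | u v. u \<in> V \<and> v \<in> V \<and> u \<noteq> v}"

definition nbhd :: "'v set set \<Rightarrow> 'v \<Rightarrow> 'v set" where
  "nbhd E v = {l. {v, l} \<in> E}"

definition edge_space :: "'v::finite set set \<Rightarrow> (real ^ ('v set)) set" where
  "edge_space E = {x. \<forall>e. e \<notin> E \<longrightarrow> x $ e = 0}"

definition cut_vector :: "'v::finite set set \<Rightarrow> 'v set \<Rightarrow> real ^ ('v set)" where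
  "cut_vector E S = (\<chi> e. if e \<in> E \<and> card (S \<inter> e) = 1 then 1 else 0)"

definition cut_polytope :: "'v::finite set \<Rightarrow> 'v set set \<Rightarrow> (real ^ ('v set)) set" where
  "cut_polytope V E = convex hull {cut_vector E S | S. S \<subseteq> V}"

definition facet_inducing ::
    "real ^ ('v::finite set) \<Rightarrow> real \<Rightarrow> (real ^ ('v set)) set \<Rightarrow> bool" where
  "facet_inducing a a0 P \<longleftrightarrow>
     (\<forall>x\<in>P. a \<bullet> x \<le> a0) \<and> {x \<in> P. a \<bullet> x = a0} facet_of P"

definition support_edges :: "'v::finite set set \<Rightarrow> real ^ ('v set) \<Rightarrow> 'v set set" where
  "support_edges E a = {e \<in> E. a $ e \<noteq> 0}"

definition completely_supported ::
    "'v::finite set set \<Rightarrow> real ^ ('v set) \<Rightarrow> 'v set set \<Rightarrow> bool" where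
  "completely_supported E a D \<longleftrightarrow> support_edges E a \<subseteq> D"

text \<open>\<open>tri_diff u v w\<close> is \<open>\<Delta>(u,v;w)\<close> and \<open>tri_sum u v w\<close> is \<open>\<Delta>(u,v,w)\<close>.\<close>

definition tri_diff :: "'v::finite \<Rightarrow> 'v \<Rightarrow> 'v \<Rightarrow> real ^ ('v set) \<Rightarrow> real" where
  "tri_diff u v w x = x $ {u, v} - x $ {u, w} - x $ {v, w}"

definition tri_sum :: "'v::finite \<Rightarrow> 'v \<Rightarrow> 'v \<Rightarrow> real ^ ('v set) \<Rightarrow> real" where
  "tri_sum u v w x = x $ {u, v} + x $ {u, w} + x $ {v, w} - 2"

definition tri_forms :: "'v::finite \<Rightarrow> 'v \<Rightarrow> 'v \<Rightarrow> (real ^ ('v set) \<Rightarrow> real) set" where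
  "tri_forms u v w = {tri_diff u v w, tri_diff w v u, tri_diff u w v, tri_sum u v w}"

text \<open>
  The edges \<open>F = {u\<^sub>1v\<^sub>1, \<dots>, u\<^sub>tv\<^sub>t}\<close> are given by an enumeration without repetition; \<open>w i\<close> is the
  node associated with the edge \<open>{u i, v i}\<close>.
\<close>

definition enumerates_edges ::
    "'v set set \<Rightarrow> nat \<Rightarrow> (nat \<Rightarrow> 'v) \<Rightarrow> (nat \<Rightarrow> 'v) \<Rightarrow> bool" where
  "enumerates_edges F t u v \<longleftrightarrow>
     F = {{u i, v i} | i. i \<in> {1..t}} \<and> inj_on (\<lambda>i. {u i, v i}) {1..t}"

text \<open>
  The condition \<open>E' \<inter> E = E - F\<close> is meant to say that \<open>E'\<close> and \<open>E - F\<close> have the same edges inside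
  \<open>V\<close>, but by itself it still lets \<open>E'\<close> contain edges between two nodes of \<open>V\<close> that are not edges
  of \<open>G\<close>.  With such edges facets need not be preserved, even for \<open>t = 0\<close>: \<open>x\<^sub>1\<^sub>2 \<le> 1\<close> is facet
  inducing for the path \<open>1-2-3\<close> but not for the triangle on \<open>1, 2, 3\<close>.  The theorem therefore
  states the missing half of that reading as a separate assumption, \<open>no_new_edges\<close>.
\<close>

definition graph_triangular_elimination ::
    "'v set \<Rightarrow> 'v set set \<Rightarrow> 'v set set \<Rightarrow> nat \<Rightarrow> (nat \<Rightarrow> 'v) \<Rightarrow> (nat \<Rightarrow> 'v) \<Rightarrow> (nat \<Rightarrow> 'v) \<Rightarrow>
     'v set \<Rightarrow> 'v set set \<Rightarrow> bool" where
  "graph_triangular_elimination V E F t u v w V' E' \<longleftrightarrow>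
     inj_on w {1..t} \<and> w ` {1..t} \<inter> V = {} \<and>
     V' = V \<union> w ` {1..t} \<and>
     (\<forall>i\<in>{1..t}. {{w i, u i}, {w i, v i}} \<subseteq> E') \<and>
     E' \<inter> E = E - F"

text \<open>
  The identity of affine functions is required on all of \<open>real ^ ('v set)\<close>, so it compares the
  coefficients at every pair of nodes and the constant terms.
\<close>

definition ineq_triangular_elimination ::
    "real ^ ('v::finite set) \<Rightarrow> real \<Rightarrow> nat \<Rightarrow> (nat \<Rightarrow> 'v) \<Rightarrow> (nat \<Rightarrow> 'v) \<Rightarrow> (nat \<Rightarrow> 'v) \<Rightarrow>
     real ^ ('v set) \<Rightarrow> real \<Rightarrow> bool" where
  "ineq_triangular_elimination a a0 t u v w a' a0' \<longleftrightarrow>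
     (\<exists>\<Delta>. (\<forall>i\<in>{1..t}. \<Delta> i \<in> tri_forms (u i) (v i) (w i)) \<and>
          (\<forall>x. a' \<bullet> x - a0' =
               a \<bullet> x - a0 + (\<Sum>i=1..t. \<bar>a $ {u i, v i}\<bar> * \<Delta> i x)))"

end

theory Submission
  imports Defs
begin

text \<open>
  Since cut vectors affinely span the edge space, a valid inequality with a root and a non-root is
  facet inducing iff every affine form on the edge space that vanishes on its roots is a multiple
  of it.  On a cut with signs \<open>\<sigma>\<close>, a triangular form with coefficients \<open>\<alpha>\<close>, \<open>\<beta>\<close> at \<open>wu\<close>, \<open>wv\<close> is
  \<open>0\<close>, except that it is \<open>-2\<close> when \<open>\<alpha> \<sigma>\<^sub>u = \<beta> \<sigma>\<^sub>v = \<sigma>\<^sub>w\<close>.  Hence every root of the old inequality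
  extends to a root of the new one, and \<open>w\<close> may be put on either side when \<open>\<alpha> \<sigma>\<^sub>u \<noteq> \<beta> \<sigma>\<^sub>v\<close>.

  Let \<open>b x - b\<^sub>0\<close> vanish on the new roots.  Moving \<open>w\<^sub>i\<close> across such a root gives a linear relation
  between the coefficients of \<open>b\<close> at \<open>w\<^sub>i\<close>; it yields an affine form on the old edge space, supported
  on the edges from \<open>u\<^sub>i\<close>, \<open>v\<^sub>i\<close> to neighbours of \<open>w\<^sub>i\<close>, that vanishes on all old roots and so is \<open>0\<close>
  by (iii).  Therefore \<open>b x - b\<^sub>0\<close> minus suitable multiples of the \<open>\<Delta>\<^sub>i\<close> involves only old edges and
  is a multiple of the old inequality.  The missing coordinates \<open>u\<^sub>iv\<^sub>i\<close> force the multiples of the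
  \<open>\<Delta>\<^sub>i\<close> to match those in the triangular elimination.
\<close>

section \<open>Cut vectors and sign vectors\<close>

abbreviation full_cut :: "'v::finite set \<Rightarrow> real ^ ('v set)" where
  "full_cut \<equiv> cut_vector UNIV"

text \<open>Signs turn the cut condition on a pair into a product, so relations between cut
  coordinates become polynomial identities in values \<open>1\<close> and \<open>-1\<close>.\<close>

definition side :: "'v set \<Rightarrow> 'v \<Rightarrow> real" where
  "side S l = (if l \<in> S then -1 else 1)"

lemma side_cases: "side S l = 1 \<or> side S l = -1"
  by (simp add: side_def)

lemma full_cut_pair:
  assumes "p \<noteq> q"
  shows "full_cut S $ {p, q} = (1 - side S p * side S q) / 2"
proof -
  have "S \<inter> {p, q} = (if p \<in> S then {p} else {}) \<union> (if q \<in> S then {q} else {})"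
    by auto
  then show ?thesis
    using assms by (auto simp: cut_vector_def side_def)
qed

lemma simple_graph_edgeE:
  assumes "simple_graph V E" "e \<in> E"
  obtains p q where "e = {p, q}" "p \<in> V" "q \<in> V" "p \<noteq> q"
  using assms unfolding simple_graph_def by blast

lemma simple_graph_edgeD:
  assumes "simple_graph V E" "{p, q} \<in> E"
  shows "p \<noteq> q" "p \<in> V" "q \<in> V"
  using simple_graph_edgeE[OF assms] by (auto simp: doubleton_eq_iff)

lemma subspace_edge_space: "subspace (edge_space E)"
  by (auto simp: subspace_def edge_space_def)

lemma axis_in_edge_space: "e \<in> E \<Longrightarrow> axis e 1 \<in> edge_space E"
  by (auto simp: edge_space_def axis_def)

lemma cut_vector_in_edge_space: "cut_vector E S \<in> edge_space E"
  by (simp add: edge_space_def cut_vector_def)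

text \<open>Coordinates outside \<open>E\<close> do not count against a vector of
  \<open>edge_space E\<close>. Hence \<open>full_cut\<close>, which is tied to no particular graph,
  can replace the cut vectors of both graphs.\<close>

lemma inner_cut_vector_eq:
  assumes "c \<in> edge_space E" "\<And>e. e \<in> E \<Longrightarrow> S \<inter> e = T \<inter> e"
  shows "c \<bullet> cut_vector E S = c \<bullet> full_cut T"
  unfolding inner_vec_def
  using assms by (intro sum.cong refl) (auto simp: edge_space_def cut_vector_def)

lemma inner_full_cut_restrict:
  assumes "simple_graph V E" "c \<in> edge_space E"
  shows "c \<bullet> full_cut (S \<inter> V) = c \<bullet> full_cut S"
proof -
  have "S \<inter> V \<inter> e = S \<inter> e" if "e \<in> E" for e
    using assms(1) that by (auto elim!: simple_graph_edgeE)
  then show ?thesis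
    using inner_cut_vector_eq[OF assms(2), of "S \<inter> V" S]
      inner_cut_vector_eq[OF assms(2), of "S \<inter> V" "S \<inter> V"] by simp
qed

text \<open>The combination of the cuts \<open>{p}\<close> plus \<open>{q}\<close> minus
  \<open>{p, q}\<close> is 2 at the edge \<open>{p, q}\<close> and 0 at all other edges, so it
  isolates one coordinate of \<open>c\<close>. The empty cut is the zero vector and settles
  \<open>c0\<close>.\<close>

lemma cut_vectors_separate:
  assumes "simple_graph V E" "c \<in> edge_space E"
    and const: "\<And>S. S \<subseteq> V \<Longrightarrow> c \<bullet> full_cut S = c0"
  shows "c = 0 \<and> c0 = 0"
proof
  have "full_cut {} = (0 :: real ^ ('a set))"
    by (simp add: cut_vector_def vec_eq_iff)
  then show c0: "c0 = 0"
    using const[of "{}"] by simp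
  have "c $ e = 0" for e
  proof (cases "e \<in> E")
    case True
    obtain p q where e: "e = {p, q}" "p \<in> V" "q \<in> V" "p \<noteq> q"
      using assms(1) True by (rule simple_graph_edgeE)
    have "c $ f * (full_cut {p} $ f + full_cut {q} $ f - full_cut {p, q} $ f)
          = c $ f * (2 * axis e 1 $ f)" for f
    proof (cases "f \<in> E")
      case True
      then obtain r s where "f = {r, s}" "r \<noteq> s"
        using assms(1) by (auto elim: simple_graph_edgeE)
      then show ?thesis
        using e by (auto simp: full_cut_pair side_def axis_def doubleton_eq_iff)
    next
      case False
      then show ?thesis
        using assms(2) by (simp add: edge_space_def)
    qed
    then have "c \<bullet> (full_cut {p} + full_cut {q} - full_cut {p, q}) = c \<bullet> (2 *\<^sub>R axis e 1)"
      unfolding inner_vec_def by (intro sum.cong refl) simp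
    moreover have "c \<bullet> full_cut {p} = 0" "c \<bullet> full_cut {q} = 0" "c \<bullet> full_cut {p, q} = 0"
      using const e c0 by auto
    ultimately show ?thesis
      by (simp add: inner_add_right inner_diff_right inner_axis)
  next
    case False
    then show ?thesis
      using assms(2) by (simp add: edge_space_def)
  qed
  then show "c = 0"
    by (simp add: vec_eq_iff)
qed

section \<open>Affine hulls and the cut polytope\<close>

lemma inner_const_affine_hull:
  assumes "\<And>x. x \<in> X \<Longrightarrow> c \<bullet> x = c0" "x \<in> affine hull X"
  shows "c \<bullet> x = c0"
proof -
  have "affine hull X \<subseteq> {x. c \<bullet> x = c0}"
    using assms(1) by (intro hull_minimal affine_hyperplane) auto
  then show ?thesis
    using assms(2) by auto
qed

lemma aff_dim_insert_outside:
  assumes "\<And>x. x \<in> X \<Longrightarrow> c \<bullet> x = c0" "c \<bullet> p \<noteq> c0"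
  shows "aff_dim (insert p X) = aff_dim X + 1"
  using inner_const_affine_hull[of X c c0 p] assms by (auto simp: aff_dim_insert)

text \<open>An affine hull is an intersection of hyperplanes, and one of them misses
  \<open>q\<close>.\<close>

lemma outside_affine_hull:
  fixes X :: "'a::euclidean_space set"
  assumes "q \<notin> affine hull X"
  obtains d d0 where "\<And>x. x \<in> X \<Longrightarrow> d \<bullet> x = d0" "d \<bullet> q \<noteq> d0"
proof -
  obtain \<F> where hull: "affine hull X = \<Inter>\<F>"
    and planes: "\<And>h. h \<in> \<F> \<Longrightarrow> \<exists>d d0. d \<noteq> 0 \<and> h = {x. d \<bullet> x = d0}"
    by (rule affine_hull_finite_intersection_hyperplanes[of X]) blast
  then obtain h where h: "h \<in> \<F>" "q \<notin> h"
    using assms by blast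
  then obtain d d0 where d: "h = {x. d \<bullet> x = d0}"
    using planes by blast
  have "X \<subseteq> h"
    using hull_subset[of X affine] hull h(1) by blast
  then show ?thesis
    using that[of d d0] h(2) d by blast
qed

lemma cut_in_polytope: "S \<subseteq> V \<Longrightarrow> cut_vector E S \<in> cut_polytope V E"
  unfolding cut_polytope_def by (rule hull_inc) auto

lemma cut_polytope_in_edge_space: "cut_polytope V E \<subseteq> edge_space E"
  unfolding cut_polytope_def
  using cut_vector_in_edge_space subspace_imp_convex[OF subspace_edge_space]
  by (intro hull_minimal) auto

lemma cut_polytope_valid:
  assumes "\<And>S. S \<subseteq> V \<Longrightarrow> a \<bullet> cut_vector E S \<le> a0" "x \<in> cut_polytope V E"
  shows "a \<bullet> x \<le> a0"
proof -
  have "cut_polytope V E \<subseteq> {x. a \<bullet> x \<le> a0}"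
    unfolding cut_polytope_def
    using assms(1) by (intro hull_minimal convex_halfspace_le) auto
  then show ?thesis
    using assms(2) by auto
qed

lemma cut_polytope_const:
  assumes "\<And>S. S \<subseteq> V \<Longrightarrow> a \<bullet> cut_vector E S = a0" "x \<in> cut_polytope V E"
  shows "a \<bullet> x = a0"
proof (rule inner_const_affine_hull)
  show "x \<in> affine hull {cut_vector E S | S. S \<subseteq> V}"
    using assms(2) convex_hull_subset_affine_hull unfolding cut_polytope_def by blast
qed (use assms(1) in auto)

section \<open>Facets characterised by the affine forms vanishing on their roots\<close>

lemma facet_inducing_unique:
  assumes G: "simple_graph V E" and a: "a \<in> edge_space E"
    and facet: "facet_inducing a a0 (cut_polytope V E)"
    and c: "c \<in> edge_space E"
    and roots: "\<And>S. S \<subseteq> V \<Longrightarrow> a \<bullet> full_cut S = a0 \<Longrightarrow> c \<bullet> full_cut S = c0"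
  shows "\<exists>r. c = r *\<^sub>R a \<and> c0 = r * a0"
proof -
  let ?P = "cut_polytope V E"
  let ?F = "{x \<in> ?P. a \<bullet> x = a0}"
  have face: "?F face_of ?P" and dim: "aff_dim ?F = aff_dim ?P - 1"
    using facet by (auto simp: facet_inducing_def facet_of_def)
  have cF: "c \<bullet> x = c0" if "x \<in> ?F" for x
  proof -
    \<comment> \<open>A face of the hull of a compact set is the hull of some of the generators,
      here of root cuts, so the assumption on roots carries over to the whole face.\<close>
    have "compact {cut_vector E S | S. S \<subseteq> V}"
      by (intro finite_imp_compact) simp
    then obtain R where R: "R \<subseteq> {cut_vector E S | S. S \<subseteq> V}" "?F = convex hull R"
      using face[unfolded cut_polytope_def]
      by (rule face_of_convex_hull_subset) (simp add: cut_polytope_def)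
    have "c \<bullet> y = c0" if y: "y \<in> R" for y
    proof -
      obtain S where S: "S \<subseteq> V" "y = cut_vector E S"
        using R(1) y by auto
      have "y \<in> ?F"
        using R(2) hull_inc[OF y] by metis
      then show ?thesis
        using S roots[of S] inner_cut_vector_eq[OF a, of S S] inner_cut_vector_eq[OF c, of S S]
        by simp
    qed
    moreover have "x \<in> affine hull R"
      using R(2) that convex_hull_subset_affine_hull by blast
    ultimately show ?thesis
      by (rule inner_const_affine_hull)
  qed
  have "?F \<noteq> ?P"
    using dim by auto
  then obtain p where p: "p \<in> ?P" "a \<bullet> p \<noteq> a0"
    by auto
  \<comment> \<open>This multiple makes
    \<open>(c - r *\<^sub>R a) \<bullet> x - (c0 - r * a0)\<close> vanish at \<open>p\<close> as
    well. The facet and \<open>p\<close> affinely span the polytope, so the form vanishes on all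
    cuts.\<close>
  define r where "r = (c \<bullet> p - c0) / (a \<bullet> p - a0)"
  have r: "(c - r *\<^sub>R a) \<bullet> p = c0 - r * a0"
    using p(2) by (simp add: r_def inner_diff_left field_simps)
  have "aff_dim (insert p ?F) = aff_dim ?P"
    using aff_dim_insert_outside[of ?F a a0 p] dim p(2) by simp
  then have hull: "affine hull (insert p ?F) = affine hull ?P"
    using p(1) by (intro aff_dim_eq_full_gen[THEN iffD1]) auto
  have on_F: "(c - r *\<^sub>R a) \<bullet> x = c0 - r * a0" if "x \<in> insert p ?F" for x
  proof (cases "x = p")
    case True
    then show ?thesis
      using r by simp
  next
    case False
    then have "a \<bullet> x = a0" "c \<bullet> x = c0"
      using that cF by auto
    then show ?thesis
      by (simp add: inner_diff_left)
  qed
  have on_P: "(c - r *\<^sub>R a) \<bullet> x = c0 - r * a0" if "x \<in> ?P" for x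
    using on_F
  proof (rule inner_const_affine_hull)
    show "x \<in> affine hull (insert p ?F)"
      unfolding hull using that by (rule hull_inc)
  qed
  have space: "c - r *\<^sub>R a \<in> edge_space E"
    using a c subspace_edge_space by (auto intro: subspace_diff subspace_scale)
  have "c - r *\<^sub>R a = 0 \<and> c0 - r * a0 = 0"
  proof (rule cut_vectors_separate[OF G space])
    show "(c - r *\<^sub>R a) \<bullet> full_cut S = c0 - r * a0" if "S \<subseteq> V" for S
      using on_P[OF cut_in_polytope[OF that]] inner_cut_vector_eq[OF space, of S S] by simp
  qed
  then show ?thesis
    by auto
qed

text \<open>A hyperplane normal found in the ambient space may have coordinates outside
  \<open>E\<close>; erasing them does not change its values on the polytope.\<close>

lemma edge_space_projection:
  obtains c' where "c' \<in> edge_space E" "\<And>x. x \<in> edge_space E \<Longrightarrow> c' \<bullet> x = c \<bullet> x"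
proof
  show "(\<chi> e. if e \<in> E then c $ e else 0) \<in> edge_space E"
    by (simp add: edge_space_def)
  show "(\<chi> e. if e \<in> E then c $ e else 0) \<bullet> x = c \<bullet> x" if "x \<in> edge_space E" for x
    unfolding inner_vec_def using that by (intro sum.cong refl) (auto simp: edge_space_def)
qed

text \<open>If the face together with one non-root failed to span the polytope, a hyperplane through
  both would give a form excluded by \<open>unique\<close>. The root makes the face nonempty, the
  non-root makes it proper.\<close>

lemma facet_inducingI:
  assumes a: "a \<in> edge_space E"
    and valid: "\<And>S. S \<subseteq> V \<Longrightarrow> a \<bullet> full_cut S \<le> a0"
    and root: "S0 \<subseteq> V" "a \<bullet> full_cut S0 = a0"
    and nonroot: "S1 \<subseteq> V" "a \<bullet> full_cut S1 \<noteq> a0"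
    and unique: "\<And>c c0. c \<in> edge_space E \<Longrightarrow>
       (\<And>S. S \<subseteq> V \<Longrightarrow> a \<bullet> full_cut S = a0 \<Longrightarrow> c \<bullet> full_cut S = c0) \<Longrightarrow>
       \<exists>r. c = r *\<^sub>R a \<and> c0 = r * a0"
  shows "facet_inducing a a0 (cut_polytope V E)"
proof -
  let ?P = "cut_polytope V E"
  let ?F = "{x \<in> ?P. a \<bullet> x = a0}"
  have cuts: "d \<bullet> cut_vector E S = d \<bullet> full_cut S" if "d \<in> edge_space E" for d S
    using inner_cut_vector_eq[OF that, of S S] by simp
  have le: "a \<bullet> x \<le> a0" if "x \<in> ?P" for x
    using _ that
  proof (rule cut_polytope_valid)
    show "a \<bullet> cut_vector E S \<le> a0" if "S \<subseteq> V" for S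
      unfolding cuts[OF a] using that by (rule valid)
  qed
  have "convex ?P"
    by (simp add: cut_polytope_def)
  then have "?P \<inter> {x. a \<bullet> x = a0} face_of ?P"
    using le by (rule face_of_Int_supporting_hyperplane_le)
  then have face: "?F face_of ?P"
    by (simp add: Int_def)
  define p where "p = cut_vector E S1"
  have p: "p \<in> ?P" "a \<bullet> p \<noteq> a0"
    using nonroot cut_in_polytope cuts[OF a] by (auto simp: p_def)
  have dim_insert: "aff_dim (insert p ?F) = aff_dim ?F + 1"
    using aff_dim_insert_outside[of ?F a a0 p] p(2) by simp
  have "?P \<subseteq> affine hull (insert p ?F)"
  proof
    fix q assume q: "q \<in> ?P"
    show "q \<in> affine hull (insert p ?F)"
    proof (rule ccontr)
      assume "q \<notin> affine hull (insert p ?F)"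
      then obtain d d0 where d: "\<And>x. x \<in> insert p ?F \<Longrightarrow> d \<bullet> x = d0" "d \<bullet> q \<noteq> d0"
        by (rule outside_affine_hull) blast
      obtain c where c: "c \<in> edge_space E" "\<And>x. x \<in> edge_space E \<Longrightarrow> c \<bullet> x = d \<bullet> x"
        by (rule edge_space_projection[of E d]) blast
      have P: "x \<in> edge_space E" if "x \<in> ?P" for x
        using cut_polytope_in_edge_space that by blast
      have on_hull: "c \<bullet> x = d0" if "x \<in> insert p ?F" for x
      proof -
        have "x \<in> edge_space E"
          using P that p(1) by blast
        then show ?thesis
          using d(1)[OF that] c(2) by simp
      qed
      have "c \<bullet> full_cut S = d0" if "S \<subseteq> V" "a \<bullet> full_cut S = a0" for S
        using on_hull[of "cut_vector E S"] that cuts[OF c(1)] cuts[OF a] cut_in_polytope[of S V E]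
        by simp
      then obtain r where r: "c = r *\<^sub>R a" "d0 = r * a0"
        using unique[OF c(1)] by blast
      \<comment> \<open>The form vanishes at the non-root \<open>p\<close>, where the inequality is
        strict; hence it is the zero form and cannot separate \<open>q\<close>.\<close>
      have "r = 0"
        using on_hull[of p] r p(2) by simp
      moreover have "c \<bullet> q \<noteq> d0"
        using d(2) c(2)[OF P[OF q]] by simp
      ultimately show False
        using r by simp
    qed
  qed
  then have "aff_dim ?P \<le> aff_dim ?F + 1"
    using aff_dim_subset[of ?P "affine hull (insert p ?F)"] dim_insert by simp
  moreover have "aff_dim ?F < aff_dim ?P"
    using face p \<open>convex ?P\<close> by (intro face_of_aff_dim_lt) auto
  moreover have "cut_vector E S0 \<in> ?F"
    using root cut_in_polytope cuts[OF a] by auto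
  ultimately show ?thesis
    using face le by (auto simp: facet_inducing_def facet_of_def)
qed

section \<open>Moving one node across a cut\<close>

text \<open>Only edges at \<open>w\<close> change, and the coordinate at \<open>{w, l}\<close> goes
  from \<open>(1 - side S l) / 2\<close> to \<open>(1 + side S l) / 2\<close>.\<close>

lemma toggle_node:
  assumes G: "simple_graph V E" and b: "b \<in> edge_space E" and "w \<notin> S"
  shows "b \<bullet> full_cut (insert w S) - b \<bullet> full_cut S = (\<Sum>l\<in>nbhd E w. b $ {w, l} * side S l)"
proof -
  let ?d = "\<lambda>e. b $ e * (full_cut (insert w S) $ e - full_cut S $ e)"
  have inj: "inj_on (\<lambda>l. {w, l}) (nbhd E w)"
    by (auto simp: inj_on_def doubleton_eq_iff)
  have "?d e = 0" if "e \<notin> (\<lambda>l. {w, l}) ` nbhd E w" for e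
  proof (cases "e \<in> E")
    case True
    then obtain p q where e: "e = {p, q}"
      using G by (auto elim: simple_graph_edgeE)
    then have "w \<notin> e"
      using True that by (auto simp: nbhd_def image_iff doubleton_eq_iff insert_commute)
    then have "insert w S \<inter> e = S \<inter> e"
      by auto
    then show ?thesis
      by (simp add: cut_vector_def)
  next
    case False
    then show ?thesis
      using b by (simp add: edge_space_def)
  qed
  then have "sum ?d UNIV = sum ?d ((\<lambda>l. {w, l}) ` nbhd E w)"
    by (intro sum.mono_neutral_right) auto
  also have "\<dots> = (\<Sum>l\<in>nbhd E w. ?d {w, l})"
    using inj by (simp add: sum.reindex)
  also have "\<dots> = (\<Sum>l\<in>nbhd E w. b $ {w, l} * side S l)"
  proof (intro sum.cong refl)
    fix l assume "l \<in> nbhd E w"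
    then have "w \<noteq> l"
      using simple_graph_edgeD[OF G] by (auto simp: nbhd_def)
    then show "?d {w, l} = b $ {w, l} * side S l"
      using \<open>w \<notin> S\<close> by (simp add: full_cut_pair) (simp add: side_def)
  qed
  finally show ?thesis
    by (simp add: inner_vec_def sum_subtractf right_diff_distrib)
qed

section \<open>Triangular forms in terms of signs\<close>

text \<open>All four triangular forms are \<open>tri_vec \<alpha> \<beta> u v w \<bullet> x - (1 + \<alpha>) (1 + \<beta>) / 2\<close> with signs
  \<open>\<alpha>\<close>, \<open>\<beta>\<close>.\<close>

definition tri_vec :: "real \<Rightarrow> real \<Rightarrow> 'v::finite \<Rightarrow> 'v \<Rightarrow> 'v \<Rightarrow> real ^ ('v set)" where
  "tri_vec \<alpha> \<beta> u v w =
     (\<alpha> * \<beta>) *\<^sub>R axis {u, v} 1 + \<alpha> *\<^sub>R axis {w, u} 1 + \<beta> *\<^sub>R axis {w, v} 1"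

lemma inner_tri_vec:
  "tri_vec \<alpha> \<beta> u v w \<bullet> x = \<alpha> * \<beta> * x $ {u, v} + \<alpha> * x $ {w, u} + \<beta> * x $ {w, v}"
  by (simp add: tri_vec_def inner_add_left inner_axis')

text \<open>Each form has an even number of negative coefficients, so the one at
  \<open>{u, v}\<close> is the product of the other two. The constant is 2 when both signs are
  positive and 0 otherwise.\<close>

lemma tri_forms_signs:
  assumes "\<Delta> \<in> tri_forms u v w"
  shows "\<exists>\<alpha> \<beta>. \<bar>\<alpha>\<bar> = 1 \<and> \<bar>\<beta>\<bar> = 1 \<and>
    (\<forall>x. \<Delta> x = tri_vec \<alpha> \<beta> u v w \<bullet> x - (1 + \<alpha>) * (1 + \<beta>) / 2)"
proof -
  consider "\<Delta> = tri_diff u v w" | "\<Delta> = tri_diff w v u" | "\<Delta> = tri_diff u w v" | "\<Delta> = tri_sum u v w"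
    using assms by (auto simp: tri_forms_def)
  then show ?thesis
  proof cases
    case 1
    then show ?thesis
      by (intro exI[of _ "-1"]) (simp add: inner_tri_vec tri_diff_def insert_commute)
  next
    case 2
    then show ?thesis
      by (intro exI[of _ "-1"] exI[of _ 1]) (simp add: inner_tri_vec tri_diff_def insert_commute)
  next
    case 3
    then show ?thesis
      by (intro exI[of _ 1] exI[of _ "-1"]) (simp add: inner_tri_vec tri_diff_def insert_commute)
  next
    case 4
    then show ?thesis
      by (intro exI[of _ 1]) (simp add: inner_tri_vec tri_sum_def insert_commute)
  qed
qed

text \<open>As squares of signs are 1, the left side factors as \<open>- (1 + \<alpha> * side S u *
  side S w) * (1 + \<beta> * side S v * side S w) / 2\<close>.\<close>

lemma tri_vec_cut:
  assumes "distinct [u, v, w]" "\<bar>\<alpha>\<bar> = 1" "\<bar>\<beta>\<bar> = 1"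
  shows "tri_vec \<alpha> \<beta> u v w \<bullet> full_cut S - (1 + \<alpha>) * (1 + \<beta>) / 2 =
    (if \<alpha> * side S u = \<beta> * side S v \<and> side S w = \<alpha> * side S u then -2 else 0)"
proof -
  have "\<alpha> = 1 \<or> \<alpha> = -1" "\<beta> = 1 \<or> \<beta> = -1"
    using assms by (auto simp: abs_if split: if_splits)
  then show ?thesis
    using assms(1) by (elim disjE) (auto simp: inner_tri_vec full_cut_pair side_def)
qed

section \<open>Coefficients at a new node\<close>

lemma completely_supported_mono:
  "completely_supported E a D \<Longrightarrow> D \<subseteq> D' \<Longrightarrow> completely_supported E a D'"
  by (auto simp: completely_supported_def)

lemma unsupported_multiple_zero:
  assumes "r *\<^sub>R a = c" "\<not> completely_supported E a D"
    and "\<And>e. e \<notin> D \<Longrightarrow> c $ e = 0"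
  shows "r = 0"
proof -
  obtain e where "e \<notin> D" "a $ e \<noteq> 0"
    using assms(2) by (auto simp: completely_supported_def support_edges_def)
  then show ?thesis
    using assms(1,3) by (metis mult_eq_0_iff real_scaleR_def vector_scaleR_component)
qed

text \<open>In the application \<open>y l\<close> is the coefficient of a form at the edge from the
  new node to \<open>l\<close>, and \<open>roots\<close> is the relation obtained by moving that
  node. Multiplied by \<open>\<alpha> * side S u - \<beta> * side S v\<close>, the relation holds at
  every root and becomes an affine form on the old edges \<open>{u, v}\<close>,
  \<open>{u, l}\<close>, \<open>{v, l}\<close>. Uniqueness makes it a multiple of the old
  inequality, non-support makes it zero.\<close>

lemma apex_coefficients:
  fixes y :: "'v::finite \<Rightarrow> real"
  assumes G: "simple_graph V E" and a: "a \<in> edge_space E"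
    and facet: "facet_inducing a a0 (cut_polytope V E)"
    and uv: "{u, v} \<in> E" and M: "M \<subseteq> nbhd E u \<inter> nbhd E v"
    and unsupported: "\<not> completely_supported E a
        (insert {u, v} ((\<lambda>l. {u, l}) ` M \<union> (\<lambda>l. {v, l}) ` M))"
    and signs: "\<bar>\<alpha>\<bar> = 1" "\<bar>\<beta>\<bar> = 1"
    and roots: "\<And>S. S \<subseteq> V \<Longrightarrow> a \<bullet> full_cut S = a0 \<Longrightarrow> \<alpha> * side S u \<noteq> \<beta> * side S v \<Longrightarrow>
        y u * side S u + y v * side S v + (\<Sum>l\<in>M. y l * side S l) = 0"
  shows "\<alpha> * y u = \<beta> * y v" "\<And>l. l \<in> M \<Longrightarrow> y l = 0"
proof -
  have sgn: "\<alpha> = 1 \<or> \<alpha> = -1" "\<beta> = 1 \<or> \<beta> = -1"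
    using signs by (auto simp: abs_if split: if_splits)
  have edges: "{u, l} \<in> E" "{v, l} \<in> E" "l \<noteq> u" "l \<noteq> v" if "l \<in> M" for l
  proof -
    show "{u, l} \<in> E" "{v, l} \<in> E"
      using M that by (auto simp: nbhd_def)
    then show "l \<noteq> u" "l \<noteq> v"
      using simple_graph_edgeD(1)[OF G] by metis+
  qed
  have "u \<noteq> v"
    using simple_graph_edgeD[OF G uv] by simp
  \<comment> \<open>Up to the factor 2, \<open>c x - c\<^sub>0\<close> is the assumed relation times \<open>\<alpha> \<sigma>\<^sub>u - \<beta> \<sigma>\<^sub>v\<close>, which
    vanishes where the relation is not assumed; see \<open>c_cut\<close>.\<close>
  define k where "k = \<alpha> * y u - \<beta> * y v"
  define c where "c = (\<alpha> * \<beta> * k) *\<^sub>R axis {u, v} 1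
      + (\<Sum>l\<in>M. y l *\<^sub>R (\<beta> *\<^sub>R axis {v, l} 1 - \<alpha> *\<^sub>R axis {u, l} (1::real)))"
  define c0 where "c0 = (\<alpha> * \<beta> - 1) * k / 2 + (\<Sum>l\<in>M. y l * (\<beta> - \<alpha>) / 2)"
  have c_space: "c \<in> edge_space E"
    unfolding c_def using uv edges subspace_edge_space
    by (intro subspace_add subspace_scale subspace_sum subspace_diff axis_in_edge_space) auto
  have c_cut: "2 * (c \<bullet> full_cut S - c0) = (\<alpha> * side S u - \<beta> * side S v) *
      (y u * side S u + y v * side S v + (\<Sum>l\<in>M. y l * side S l))" for S
  proof -
    have "2 * (\<Sum>l\<in>M. y l * (\<beta> * full_cut S $ {v, l} - \<alpha> * full_cut S $ {u, l}))
        - 2 * (\<Sum>l\<in>M. y l * (\<beta> - \<alpha>) / 2)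
        = (\<alpha> * side S u - \<beta> * side S v) * (\<Sum>l\<in>M. y l * side S l)"
      unfolding sum_distrib_left sum_subtractf[symmetric]
    proof (rule sum.cong[OF refl])
      fix l assume "l \<in> M"
      then have "v \<noteq> l" "u \<noteq> l"
        using edges by auto
      then show "2 * (y l * (\<beta> * full_cut S $ {v, l} - \<alpha> * full_cut S $ {u, l}))
          - 2 * (y l * (\<beta> - \<alpha>) / 2) = (\<alpha> * side S u - \<beta> * side S v) * (y l * side S l)"
        by (simp add: full_cut_pair) (simp add: field_simps)
    qed
    moreover have "c \<bullet> full_cut S = \<alpha> * \<beta> * k * full_cut S $ {u, v}
        + (\<Sum>l\<in>M. y l * (\<beta> * full_cut S $ {v, l} - \<alpha> * full_cut S $ {u, l}))"
      by (simp add: c_def inner_add_left inner_diff_left inner_sum_left inner_axis')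
    \<comment> \<open>Since squares of signs are 1, the product on the right equals
      \<open>k - \<alpha> * \<beta> * k * side S u * side S v\<close>, so the single number
      \<open>k\<close> governs both the constant and the coordinate at
      \<open>{u, v}\<close>.\<close>
    moreover have "2 * (\<alpha> * \<beta> * k * full_cut S $ {u, v}) - (\<alpha> * \<beta> - 1) * k
        = (\<alpha> * side S u - \<beta> * side S v) * (y u * side S u + y v * side S v)"
      using sgn \<open>u \<noteq> v\<close> by (elim disjE) (simp_all add: full_cut_pair k_def side_def)
    moreover have "2 * c0 = (\<alpha> * \<beta> - 1) * k + 2 * (\<Sum>l\<in>M. y l * (\<beta> - \<alpha>) / 2)"
      by (simp add: c0_def)
    ultimately show ?thesis
      unfolding distrib_left[of _ _ "sum _ _"] by argo
  qed
  have "c \<bullet> full_cut S = c0" if S: "S \<subseteq> V" "a \<bullet> full_cut S = a0" for S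
    using c_cut[of S] roots[OF S] by (cases "\<alpha> * side S u = \<beta> * side S v") simp_all
  then obtain r where r: "c = r *\<^sub>R a" "c0 = r * a0"
    using facet_inducing_unique[OF G a facet c_space] by blast
  have c_uv: "c $ {u, v} = \<alpha> * \<beta> * k"
  proof -
    have "(\<Sum>l\<in>M. y l * (\<beta> * axis {v, l} 1 $ {u, v} - \<alpha> * axis {u, l} 1 $ {u, v})) = 0"
      using edges by (intro sum.neutral) (auto simp: axis_def doubleton_eq_iff)
    then show ?thesis
      by (simp add: c_def)
  qed
  \<comment> \<open>The edges \<open>{u, v}\<close>, \<open>{u, l}\<close> and \<open>{v, l}\<close>
    for \<open>l \<in> M\<close> are pairwise distinct, so each coordinate of \<open>c\<close> shows
    one coefficient alone.\<close>
  have c_ul: "c $ {u, l} = - \<alpha> * y l" if "l \<in> M" for l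
  proof -
    have "(\<Sum>j\<in>M. y j * (\<beta> * axis {v, j} 1 $ {u, l} - \<alpha> * axis {u, j} 1 $ {u, l}))
        = (\<Sum>j\<in>M. if j = l then - \<alpha> * y l else 0)"
      using edges that \<open>u \<noteq> v\<close> by (intro sum.cong) (auto simp: axis_def doubleton_eq_iff)
    moreover have "axis {u, v} 1 $ {u, l} = (0::real)"
      using edges[OF that] by (auto simp: axis_def doubleton_eq_iff)
    ultimately show ?thesis
      using that by (simp add: c_def)
  qed
  have "r = 0"
    using r(1)[symmetric] unsupported
  proof (rule unsupported_multiple_zero)
    fix e assume e: "e \<notin> insert {u, v} ((\<lambda>l. {u, l}) ` M \<union> (\<lambda>l. {v, l}) ` M)"
    then have "axis {u, v} 1 $ e = (0::real)"
      by (auto simp: axis_def)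
    moreover have "(\<Sum>l\<in>M. y l * (\<beta> * axis {v, l} 1 $ e - \<alpha> * axis {u, l} 1 $ e)) = 0"
      using e by (intro sum.neutral) (auto simp: axis_def)
    ultimately show "c $ e = 0"
      by (simp add: c_def)
  qed
  then have "c = 0"
    using r by simp
  then show "\<alpha> * y u = \<beta> * y v"
    using c_uv sgn by (auto simp: k_def)
  show "y l = 0" if "l \<in> M" for l
    using c_ul[OF that] \<open>c = 0\<close> sgn by auto
qed

section \<open>Roots and non-roots of a facet-inducing inequality\<close>

lemma facet_inducing_cuts:
  assumes G: "simple_graph V E" and a: "a \<in> edge_space E"
    and facet: "facet_inducing a a0 (cut_polytope V E)"
  shows "S \<subseteq> V \<Longrightarrow> a \<bullet> full_cut S \<le> a0"
    and "\<exists>S\<subseteq>V. a \<bullet> full_cut S = a0"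
    and "\<exists>S\<subseteq>V. a \<bullet> full_cut S \<noteq> a0"
proof -
  let ?P = "cut_polytope V E"
  let ?F = "{x \<in> ?P. a \<bullet> x = a0}"
  have F: "?F \<noteq> {}" "aff_dim ?F = aff_dim ?P - 1" "\<And>x. x \<in> ?P \<Longrightarrow> a \<bullet> x \<le> a0"
    using facet by (auto simp: facet_inducing_def facet_of_def)
  have cuts: "a \<bullet> cut_vector E S = a \<bullet> full_cut S" for S
    using inner_cut_vector_eq[OF a, of S S] by simp
  show "a \<bullet> full_cut S \<le> a0" if "S \<subseteq> V"
    using F(3)[OF cut_in_polytope[OF that]] cuts by simp
  show "\<exists>S\<subseteq>V. a \<bullet> full_cut S = a0"
  proof (rule ccontr)
    assume "\<not> ?thesis"
    \<comment> \<open>Without roots, uniqueness would apply vacuously to the constant form with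
      \<open>c = 0\<close> and \<open>c0 = 1\<close>.\<close>
    then have "\<exists>r. 0 = r *\<^sub>R a \<and> 1 = r * a0"
      using subspace_0[OF subspace_edge_space]
      by (intro facet_inducing_unique[OF G a facet]) auto
    then obtain r where r: "r *\<^sub>R a = 0" "r * a0 = 1"
      by metis
    obtain x where "a \<bullet> x = a0"
      using F(1) by blast
    then have "(r *\<^sub>R a) \<bullet> x = r * a0"
      by simp
    then show False
      unfolding r by simp
  qed
  show "\<exists>S\<subseteq>V. a \<bullet> full_cut S \<noteq> a0"
  proof (rule ccontr)
    assume "\<not> ?thesis"
    then have "a \<bullet> cut_vector E S = a0" if "S \<subseteq> V" for S
      using that cuts by simp
    then have "?F = ?P"
      using cut_polytope_const[of V a E a0] by blast
    then show False
      using F(2) by simp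
  qed
qed

lemma tri_vec_nth:
  "tri_vec \<alpha> \<beta> u v w $ e = (if e = {u, v} then \<alpha> * \<beta> else 0)
     + (if e = {w, u} then \<alpha> else 0) + (if e = {w, v} then \<beta> else 0)"
  by (simp add: tri_vec_def axis_def)

section \<open>Triangular elimination preserves facets\<close>

theorem theorem3p9:
  fixes V V' :: "'v::finite set"
    and E E' F :: "'v set set"
    and t :: nat
    and u v w :: "nat \<Rightarrow> 'v"
    and a a' :: "real ^ ('v set)"
    and a0 a0' :: real
  assumes graph_G: "simple_graph V E"
    and graph_G': "simple_graph V' E'"
    and F_sub: "F \<subseteq> E"
    and F_enum: "enumerates_edges F t u v"
    and elim_graph: "graph_triangular_elimination V E F t u v w V' E'"
    and no_new_edges: "\<forall>e\<in>E'. e \<subseteq> V \<longrightarrow> e \<in> E"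
    and a_space: "a \<in> edge_space E"
    and a'_space: "a' \<in> edge_space E'"
    and elim_ineq: "ineq_triangular_elimination a a0 t u v w a' a0'"
    and cond_i: "facet_inducing a a0 (cut_polytope V E)"
    and cond_ii: "\<forall>i\<in>{1..t}. nbhd E' (w i) - {u i, v i} \<subseteq> nbhd E (u i) \<inter> nbhd E (v i)"
    and cond_iii: "\<forall>i\<in>{1..t}. \<not> completely_supported E a
                     ({{u i, l} | l. l \<in> nbhd E' (w i)} \<union> {{v i, l} | l. l \<in> nbhd E' (w i)})"
  shows "facet_inducing a' a0' (cut_polytope V' E')"
proof -
  let ?I = "{1..t}"
  obtain \<Delta> where \<Delta>: "\<And>i. i \<in> ?I \<Longrightarrow> \<Delta> i \<in> tri_forms (u i) (v i) (w i)"
    "\<And>x. a' \<bullet> x - a0' = a \<bullet> x - a0 + (\<Sum>i=1..t. \<bar>a $ {u i, v i}\<bar> * \<Delta> i x)"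
    using elim_ineq unfolding ineq_triangular_elimination_def by blast
  have "\<forall>i\<in>?I. \<exists>p. \<bar>fst p\<bar> = 1 \<and> \<bar>snd p\<bar> = 1 \<and> (\<forall>x. \<Delta> i x =
      tri_vec (fst p) (snd p) (u i) (v i) (w i) \<bullet> x - (1 + fst p) * (1 + snd p) / 2)"
    using tri_forms_signs[OF \<Delta>(1)] by simp
  then obtain s where s: "\<forall>i\<in>?I. \<bar>fst (s i)\<bar> = 1 \<and> \<bar>snd (s i)\<bar> = 1 \<and> (\<forall>x. \<Delta> i x =
      tri_vec (fst (s i)) (snd (s i)) (u i) (v i) (w i) \<bullet> x
      - (1 + fst (s i)) * (1 + snd (s i)) / 2)"
    by (rule bchoice[THEN exE])
  define \<alpha> \<beta> where "\<alpha> i = fst (s i)" and "\<beta> i = snd (s i)" for i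
  define g where "g i = tri_vec (\<alpha> i) (\<beta> i) (u i) (v i) (w i)" for i
  define k where "k i = (1 + \<alpha> i) * (1 + \<beta> i) / 2" for i
  define A where "A i = \<bar>a $ {u i, v i}\<bar>" for i
  have signs: "\<bar>\<alpha> i\<bar> = 1" "\<bar>\<beta> i\<bar> = 1" and \<Delta>_eq: "\<Delta> i x = g i \<bullet> x - k i" if "i \<in> ?I" for i x
    using s that by (simp_all add: \<alpha>_def \<beta>_def g_def k_def)
  have sgn: "\<alpha> i = 1 \<or> \<alpha> i = -1" "\<beta> i = 1 \<or> \<beta> i = -1" if "i \<in> ?I" for i
    using signs[OF that] by (auto simp: abs_if split: if_splits)

  have V': "V' = V \<union> w ` ?I" and w_inj: "inj_on w ?I" and w_V: "\<And>i. i \<in> ?I \<Longrightarrow> w i \<notin> V"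
    and E'_w: "\<And>i. i \<in> ?I \<Longrightarrow> {w i, u i} \<in> E' \<and> {w i, v i} \<in> E'" and E'_F: "E' \<inter> E = E - F"
    using elim_graph unfolding graph_triangular_elimination_def by blast+
  have uv_F: "{u i, v i} \<in> F" if "i \<in> ?I" for i
    using F_enum that by (auto simp: enumerates_edges_def)
  then have uv_E: "{u i, v i} \<in> E" if "i \<in> ?I" for i
    using F_sub that by blast
  have uv_inj: "i = j" if "i \<in> ?I" "j \<in> ?I" "{u i, v i} = {u j, v j}" for i j
    using F_enum that unfolding enumerates_edges_def inj_on_def by blast
  have uv: "u i \<noteq> v i" "u i \<in> V" "v i \<in> V" if "i \<in> ?I" for i
    using simple_graph_edgeD[OF graph_G uv_E[OF that]] by auto
  have uvw: "distinct [u i, v i, w i]" if "i \<in> ?I" for i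
    using uv[OF that] w_V[OF that] by auto
  \<comment> \<open>By condition (ii) every neighbour of a new node is old; in particular new nodes
    are pairwise non-adjacent.\<close>
  have nbhd_V: "nbhd E' (w i) \<subseteq> V" if "i \<in> ?I" for i
  proof
    fix l assume l: "l \<in> nbhd E' (w i)"
    show "l \<in> V"
    proof (cases "l = u i \<or> l = v i")
      case True
      then show ?thesis
        using uv[OF that] by auto
    next
      case False
      then have "{u i, l} \<in> E"
        using cond_ii l that by (auto simp: nbhd_def)
      then show ?thesis
        using simple_graph_edgeD[OF graph_G] by blast
    qed
  qed

  have elim: "a' \<bullet> x - a0' = a \<bullet> x - a0 + (\<Sum>i\<in>?I. A i * (g i \<bullet> x - k i))" for x
    using \<Delta>(2)[of x] \<Delta>_eq by (simp add: A_def)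
  have a0'_eq: "a0' = a0 + (\<Sum>i\<in>?I. A i * k i)"
    using elim[of 0] by (simp add: sum_negf)
  have "a' \<bullet> x = (a + (\<Sum>i\<in>?I. A i *\<^sub>R g i)) \<bullet> x" for x
    using elim[of x] a0'_eq
    by (simp add: inner_add_left inner_sum_left right_diff_distrib sum_subtractf)
  then have a'_eq: "a' = a + (\<Sum>i\<in>?I. A i *\<^sub>R g i)"
    using vector_eq_rdot by blast

  \<comment> \<open>\<open>loose i T\<close> says that the i-th triangular form vanishes on the cut
    \<open>T\<close>. If all of them vanish, the new slack of \<open>T\<close> is the old slack of
    \<open>T \<inter> V\<close>.\<close>
  define loose where "loose i T \<longleftrightarrow>
      \<not> (\<alpha> i * side T (u i) = \<beta> i * side T (v i) \<and> side T (w i) = \<alpha> i * side T (u i))" for i T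
  have g_cut: "g i \<bullet> full_cut T - k i = (if loose i T then 0 else -2)" if "i \<in> ?I" for i T
    using tri_vec_cut[OF uvw[OF that] signs[OF that], of T] by (simp add: g_def k_def loose_def)
  have loose_cut: "a' \<bullet> full_cut T - a0' = a \<bullet> full_cut (T \<inter> V) - a0"
    if "\<And>i. i \<in> ?I \<Longrightarrow> loose i T" for T
    using elim[of "full_cut T"] g_cut that inner_full_cut_restrict[OF graph_G a_space] by simp
  \<comment> \<open>Each \<open>w i\<close> gets the sign
    \<open>- \<alpha> i * side S (u i)\<close>, which makes every triangular form vanish.\<close>
  define ext where "ext S = S \<union> w ` {i \<in> ?I. \<alpha> i * side S (u i) = 1}" for S
  have ext_V': "ext S \<subseteq> V'" and ext_V: "ext S \<inter> V = S" if "S \<subseteq> V" for S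
    using that w_V V' by (auto simp: ext_def)
  have side_V: "side T l = side S l" if "T \<inter> V = S" "l \<in> V" for T S l
    using that by (auto simp: side_def)
  have ext_w: "w i \<in> ext S \<longleftrightarrow> \<alpha> i * side S (u i) = 1" if "S \<subseteq> V" "i \<in> ?I" for S i
    using that w_V[of i] w_inj unfolding ext_def inj_on_def by blast
  have ext_loose: "loose i (ext S)" if "S \<subseteq> V" "i \<in> ?I" for S i
    using ext_w[OF that] sgn[OF that(2)] side_cases[of S "u i"]
      side_V[OF ext_V[OF that(1)] uv(2)[OF that(2)]]
    by (auto simp: loose_def side_def[of _ "w i"])
  have ext_cut: "a' \<bullet> full_cut (ext S) - a0' = a \<bullet> full_cut S - a0" if "S \<subseteq> V" for S
    using loose_cut[of "ext S"] ext_loose ext_V that by simp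
  note a_cuts = facet_inducing_cuts[OF graph_G a_space cond_i]

  obtain S0 S1 where S0: "S0 \<subseteq> V" "a \<bullet> full_cut S0 = a0" and S1: "S1 \<subseteq> V" "a \<bullet> full_cut S1 \<noteq> a0"
    using a_cuts(2,3) by blast
  show ?thesis
    using a'_space
  proof (rule facet_inducingI[where ?S0.0 = "ext S0" and ?S1.0 = "ext S1"])
    show "ext S0 \<subseteq> V'" "ext S1 \<subseteq> V'" "a' \<bullet> full_cut (ext S0) = a0'"
      "a' \<bullet> full_cut (ext S1) \<noteq> a0'"
      using ext_V' ext_cut[of S0] ext_cut[of S1] S0 S1 by auto
  next
    fix T assume "T \<subseteq> V'"
    have "a \<bullet> full_cut T \<le> a0"
      using a_cuts(1)[of "T \<inter> V"] inner_full_cut_restrict[OF graph_G a_space] by simp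
    moreover have "(\<Sum>i\<in>?I. A i * (g i \<bullet> full_cut T - k i)) \<le> 0"
      using g_cut by (intro sum_nonpos mult_nonneg_nonpos) (auto simp: A_def)
    ultimately show "a' \<bullet> full_cut T \<le> a0'"
      using elim[of "full_cut T"] by simp
  next
    fix b b0
    assume b: "b \<in> edge_space E'"
      and b_roots: "\<And>T. T \<subseteq> V' \<Longrightarrow> a' \<bullet> full_cut T = a0' \<Longrightarrow> b \<bullet> full_cut T = b0"
    have apex: "\<alpha> i * b $ {w i, u i} = \<beta> i * b $ {w i, v i}"
      "\<And>l. l \<in> nbhd E' (w i) - {u i, v i} \<Longrightarrow> b $ {w i, l} = 0" if i: "i \<in> ?I" for i
    proof -
      let ?N = "nbhd E' (w i)"
      let ?M = "?N - {u i, v i}"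
      have N: "?N = insert (u i) (insert (v i) ?M)"
        using E'_w[OF i] by (auto simp: nbhd_def)
      have M: "?M \<subseteq> nbhd E (u i) \<inter> nbhd E (v i)"
        using cond_ii i by blast
      \<comment> \<open>As \<open>v i\<close> is itself a neighbour of \<open>w i\<close>, the edge
        \<open>{u i, v i}\<close> belongs to the set in condition (iii), so inserting it is
        harmless.\<close>
      have "v i \<in> ?N"
        using E'_w[OF i] by (simp add: nbhd_def)
      then have "{u i, v i} \<in> {{u i, l} | l. l \<in> ?N}"
        by (intro CollectI exI[of _ "v i"] conjI refl)
      then have "insert {u i, v i} ((\<lambda>l. {u i, l}) ` ?M \<union> (\<lambda>l. {v i, l}) ` ?M)
          \<subseteq> {{u i, l} | l. l \<in> ?N} \<union> {{v i, l} | l. l \<in> ?N}"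
        by auto
      from contrapos_nn[OF bspec[OF cond_iii i] completely_supported_mono[OF _ this]]
      have unsupported: "\<not> completely_supported E a
          (insert {u i, v i} ((\<lambda>l. {u i, l}) ` ?M \<union> (\<lambda>l. {v i, l}) ` ?M))" .
      have roots: "b $ {w i, u i} * side S (u i) + b $ {w i, v i} * side S (v i)
          + (\<Sum>l\<in>?M. b $ {w i, l} * side S l) = 0"
        if S: "S \<subseteq> V" "a \<bullet> full_cut S = a0" and free: "\<alpha> i * side S (u i) \<noteq> \<beta> i * side S (v i)" for S
      proof -
        \<comment> \<open>\<open>T\<close> and \<open>insert (w i) T\<close> will both be roots of
          the new inequality, and \<open>toggle_node\<close> turns their difference into the
          relation at \<open>w i\<close>.\<close>
        define T where "T = ext S - {w i}"
        have T_V: "T \<inter> V = S" "insert (w i) T \<inter> V = S"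
          using ext_V[OF S(1)] w_V[OF i] by (auto simp: T_def)
        have T_V': "T \<subseteq> V'" "insert (w i) T \<subseteq> V'"
          using ext_V'[OF S(1)] V' i by (auto simp: T_def)
        \<comment> \<open>For \<open>j = i\<close> both positions of \<open>w i\<close> are loose by
          \<open>free\<close>; for \<open>j \<noteq> i\<close> the node \<open>w j\<close> stays
          where \<open>ext S\<close> puts it.\<close>
        have "loose j X" if X: "X = T \<or> X = insert (w i) T" and j: "j \<in> ?I" for X j
        proof -
          have XV: "X \<inter> V = S"
            using X T_V by blast
          show ?thesis
          proof (cases "j = i")
            case True
            then show ?thesis
              using free side_V[OF XV uv(2)[OF i]] side_V[OF XV uv(3)[OF i]]
              by (simp add: loose_def)
          next
            case False
            then have "w j \<noteq> w i"
              using inj_onD[OF w_inj _ j i] by blast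
            then have "side X (w j) = side (ext S) (w j)"
              using X by (auto simp: side_def T_def)
            then show ?thesis
              using ext_loose[OF S(1) j] side_V[OF XV] side_V[OF ext_V[OF S(1)]] uv[OF j]
              by (simp add: loose_def)
          qed
        qed
        then have "a' \<bullet> full_cut T = a0'" "a' \<bullet> full_cut (insert (w i) T) = a0'"
          using loose_cut[of T] loose_cut[of "insert (w i) T"] T_V S(2) by simp_all
        then have "b \<bullet> full_cut (insert (w i) T) - b \<bullet> full_cut T = 0"
          using b_roots T_V' by simp
        then have "0 = (\<Sum>l\<in>?N. b $ {w i, l} * side T l)"
          using toggle_node[OF graph_G' b, of "w i" T] by (simp add: T_def)
        also have "\<dots> = (\<Sum>l\<in>?N. b $ {w i, l} * side S l)"
          using side_V[OF T_V(1)] nbhd_V[OF i] by (intro sum.cong) auto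
        also have "\<dots> = b $ {w i, u i} * side S (u i) + (b $ {w i, v i} * side S (v i)
          + (\<Sum>l\<in>?M. b $ {w i, l} * side S l))"
          using uv(1)[OF i] by (subst N) (simp add: finite)
        finally show ?thesis
          by simp
      qed
      show "\<alpha> i * b $ {w i, u i} = \<beta> i * b $ {w i, v i}"
        by (rule apex_coefficients(1)[OF graph_G a_space cond_i uv_E[OF i] M unsupported
            signs[OF i], of "\<lambda>l. b $ {w i, l}"]) (rule roots)
      show "b $ {w i, l} = 0" if "l \<in> ?M" for l
        by (rule apex_coefficients(2)[OF graph_G a_space cond_i uv_E[OF i] M unsupported
            signs[OF i], of "\<lambda>l. b $ {w i, l}"]) (rule roots that; assumption)+
    qed
    \<comment> \<open>As \<open>\<alpha> i\<close> is a sign, subtracting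
      \<open>\<mu> i *\<^sub>R g i\<close> cancels the coordinate at \<open>{w i, u i}\<close>; by
      \<open>apex\<close> it cancels the one at \<open>{w i, v i}\<close> too.\<close>
    define \<mu> where "\<mu> i = \<alpha> i * b $ {w i, u i}" for i
    define c where "c = b - (\<Sum>i\<in>?I. \<mu> i *\<^sub>R g i)"
    define c0 where "c0 = b0 - (\<Sum>i\<in>?I. \<mu> i * k i)"
    have c_nth: "c $ e = b $ e - (\<Sum>i\<in>?I. \<mu> i * g i $ e)" for e
      by (simp add: c_def)
    have "c $ e = 0" if e: "e \<notin> E" for e
    proof (cases "e \<in> E'")
      case False
      then have "g i $ e = 0" if "i \<in> ?I" for i
        using e uv_E[OF that] E'_w[OF that] by (auto simp: g_def tri_vec_nth)
      then show ?thesis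
        using False b by (simp add: c_nth edge_space_def)
    next
      case True
      \<comment> \<open>By \<open>no_new_edges\<close> an edge of \<open>E'\<close> outside
        \<open>E\<close> does not lie inside \<open>V\<close>, so it contains a new node.\<close>
      then have "e \<subseteq> V'" "\<not> e \<subseteq> V"
        using graph_G' no_new_edges e by (auto elim: simple_graph_edgeE)
      then obtain i where i: "i \<in> ?I" "w i \<in> e"
        using V' by blast
      then obtain l where l: "e = {w i, l}"
        using True graph_G' by (auto elim!: simple_graph_edgeE)
      then have l_N: "l \<in> nbhd E' (w i)"
        using True by (simp add: nbhd_def)
      have "g j $ e = 0" if j: "j \<in> ?I" "j \<noteq> i" for j
      proof -
        have "w j \<noteq> w i"
          using inj_onD[OF w_inj _ j(1) i(1)] j(2) by blast
        moreover have "w j \<noteq> l"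
          using nbhd_V[OF i(1)] l_N w_V[OF j(1)] by auto
        ultimately show ?thesis
          using uv[OF j(1)] w_V[OF i(1)] by (auto simp: g_def tri_vec_nth l doubleton_eq_iff)
      qed
      then have "(\<Sum>j\<in>?I. \<mu> j * g j $ e) = (\<Sum>j\<in>?I. if j = i then \<mu> i * g i $ e else 0)"
        by (intro sum.cong) auto
      then have c_e: "c $ e = b $ {w i, l} - \<mu> i * g i $ {w i, l}"
        using i(1) by (simp add: c_nth l)
      have g_e: "g i $ {w i, l} = (if l = u i then \<alpha> i else 0) + (if l = v i then \<beta> i else 0)"
        using uvw[OF i(1)] by (auto simp: g_def tri_vec_nth doubleton_eq_iff)
      consider "l = u i" | "l = v i" | "l \<in> nbhd E' (w i) - {u i, v i}"
        using l_N by blast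
      then show ?thesis
      proof cases
        case 1
        then show ?thesis
          using c_e g_e uv(1)[OF i(1)] sgn[OF i(1)] by (auto simp: \<mu>_def)
      next
        case 2
        then show ?thesis
          using c_e g_e uv(1)[OF i(1)] sgn(2)[OF i(1)] apex(1)[OF i(1)] by (auto simp: \<mu>_def)
      next
        case 3
        then show ?thesis
          using c_e g_e apex(2)[OF i(1) 3] by simp
      qed
    qed
    then have c_space: "c \<in> edge_space E"
      by (simp add: edge_space_def)
    have "c \<bullet> full_cut S = c0" if S: "S \<subseteq> V" "a \<bullet> full_cut S = a0" for S
    proof -
      \<comment> \<open>\<open>c\<close> sees only old edges, so \<open>S\<close> may be replaced by
        its extension, where all triangular forms vanish and \<open>b\<close> takes its root
        value.\<close>
      have "c \<bullet> full_cut S = c \<bullet> full_cut (ext S)"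
        using inner_full_cut_restrict[OF graph_G c_space, of "ext S"] ext_V[OF S(1)] by simp
      also have "\<dots> = b \<bullet> full_cut (ext S) - (\<Sum>i\<in>?I. \<mu> i * (g i \<bullet> full_cut (ext S)))"
        by (simp add: c_def inner_diff_left inner_sum_left)
      also have "(\<Sum>i\<in>?I. \<mu> i * (g i \<bullet> full_cut (ext S))) = (\<Sum>i\<in>?I. \<mu> i * k i)"
        using g_cut[of _ "ext S"] ext_loose[OF S(1)] by (intro sum.cong) auto
      also have "b \<bullet> full_cut (ext S) = b0"
        using b_roots[OF ext_V'[OF S(1)]] ext_cut[OF S(1)] S(2) by simp
      finally show ?thesis
        by (simp add: c0_def)
    qed
    then obtain r where r: "c = r *\<^sub>R a" "c0 = r * a0"
      using facet_inducing_unique[OF graph_G a_space cond_i c_space] by blast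
    \<comment> \<open>The edge \<open>{u i, v i}\<close> is eliminated from \<open>E'\<close>, so
      \<open>a'\<close> and \<open>b\<close> both vanish there. Among the \<open>g j\<close> only
      \<open>g i\<close> has this coordinate, so the two cancellations determine \<open>A i\<close>
      and \<open>\<mu> i\<close> from \<open>a\<close> and \<open>r *\<^sub>R a\<close>.\<close>
    have \<mu>_eq: "\<mu> i = r * A i" if i: "i \<in> ?I" for i
    proof -
      have not_E': "{u i, v i} \<notin> E'"
        using E'_F uv_F[OF i] uv_E[OF i] by blast
      have sum_g: "(\<Sum>j\<in>?I. m j * g j $ {u i, v i}) = m i * (\<alpha> i * \<beta> i)" for m
      proof -
        have "g j $ {u i, v i} = (if j = i then \<alpha> i * \<beta> i else 0)" if j: "j \<in> ?I" for j
        proof -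
          have "w j \<noteq> u i" "w j \<noteq> v i"
            using uv[OF i] w_V[OF j] by auto
          then have "{u i, v i} \<noteq> {w j, u j}" "{u i, v i} \<noteq> {w j, v j}"
            by (auto simp: doubleton_eq_iff)
          then show ?thesis
            using uv_inj[OF i j] by (auto simp: g_def tri_vec_nth)
        qed
        then have "(\<Sum>j\<in>?I. m j * g j $ {u i, v i})
            = (\<Sum>j\<in>?I. if j = i then m i * (\<alpha> i * \<beta> i) else 0)"
          by (intro sum.cong) auto
        then show ?thesis
          using i by simp
      qed
      have zero: "a' $ {u i, v i} = 0" "b $ {u i, v i} = 0"
        using not_E' b a'_space by (auto simp: edge_space_def)
      have "a $ {u i, v i} = - (A i * (\<alpha> i * \<beta> i))"
        using sum_g[of A] zero(1) by (simp add: a'_eq)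
      moreover have "r * a $ {u i, v i} = - (\<mu> i * (\<alpha> i * \<beta> i))"
        using r(1) c_nth[of "{u i, v i}"] sum_g[of \<mu>] zero(2) by simp
      ultimately have "r * A i * (\<alpha> i * \<beta> i) = \<mu> i * (\<alpha> i * \<beta> i)"
        by simp
      then show ?thesis
        using sgn[OF i] by auto
    qed
    have "b = c + (\<Sum>i\<in>?I. \<mu> i *\<^sub>R g i)"
      by (simp add: c_def)
    also have "\<dots> = r *\<^sub>R a'"
      using r(1) \<mu>_eq by (simp add: a'_eq scaleR_add_right scaleR_sum_right)
    finally have "b = r *\<^sub>R a'" .
    moreover have "b0 = c0 + (\<Sum>i\<in>?I. \<mu> i * k i)"
      by (simp add: c0_def)
    then have "b0 = r * a0'"
      using r(2) \<mu>_eq by (simp add: a0'_eq distrib_left sum_distrib_left mult.assoc)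
    ultimately show "\<exists>r. b = r *\<^sub>R a' \<and> b0 = r * a0'"
      by blast
  qed
qed

end
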